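(* Let $n\ge2$, let $A=[a_{ij}]\in\mathbb{R}^{n\times n}$ be a nonnegative matrix with zero diagonal and let $\alpha_{ij}\in(0,1)$ be given for all $i$ and all $j\in N_i=\{j\ne i: a_{ij}>0\}$. Consider the system of $n$ agents $\dot x_i(t)=u_i(t)$, $i=1,\dots,n$, with $x_i(t)\in\mathbb{R}$ and $$u_i=\sum_{j\in N_i}a_{ij}\operatorname{sig}(x_j-x_i)^{\alpha_{ij}}$$ (with $u_i=0$ if $N_i=\emptyset$). Suppose that the system consists of one leader and $n-1$ followers and that the local communication topology among the followers is undirected and connected. If $\alpha_{ij}=\alpha_{ji}$ for all $i,j$ such that agents $i$ and $j$ are neighbors of each other (i.e. $j\in N_i$ and $i\in N_j$), then the system solves a finite-time consensus problem and the final common state is the state of the leader.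
   Context: For $r\in\mathbb{R}$ and $\alpha>0$, $\operatorname{sig}(r)^\alpha:=\operatorname{sign}(r)|r|^\alpha$, with $\operatorname{sign}(0)=0$. The weighted directed graph $\mathcal{G}(A)$ has vertices $v_1,\dots,v_n$ and an edge $(v_i,v_j)$ (from $v_i$ to $v_j$) if and only if $a_{ji}>0$, with weight $a_{ji}$. Agent $i$ is a leader if $v_i$ is the root of some spanning tree of $\mathcal{G}(A)$, i.e. every other vertex can be reached from $v_i$ by a directed path; agents that are not leaders are followers. (If there is exactly one leader, it has no neighbors, so its state is constant in time.) The local communication topology among a set of agents is the subgraph of $\mathcal{G}(A)$ induced by the corresponding vertices, with inherited weights; it is undirected if its weight matrix is symmetric, and an undirected graph is connected if any two distinct vertices are joined by a path. Solutions are differentiable functions on $[0,\infty)$. The system solves a finite-time consensus problem if for every initial state $x(0)\in\mathbb{R}^n$ and every solution $x(t)$ on $[0,\infty)$ with that initial state, $|x_j(t)-x_k(t)|\to0$ as $t\to\infty$ for all $j,k$, and there exist a time $t^*$ and a real number $\kappa$ (the final common state) such that $x_j(t)=\kappa$ for all $t\ge t^*$ and all $j$. *)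

theory Defs
  imports "HOL-Analysis.Analysis"
begin

text \<open>
  Agents are the elements of a finite index type \<open>'n\<close>, so the number of agents is \<open>CARD('n)\<close>;
  \<open>A $ i $ j\<close> is the weight \<open>a\<^sub>i\<^sub>j\<close>. The exponents \<open>\<alpha> i j\<close> are only relevant for
  \<open>j \<in> neighbors A i\<close>.
\<close>

definition sig :: "real \<Rightarrow> real \<Rightarrow> real" where
  "sig r \<alpha> = sgn r * \<bar>r\<bar> powr \<alpha>"

definition neighbors :: "real^'n^'n \<Rightarrow> 'n \<Rightarrow> 'n set" where
  "neighbors A i = {j. j \<noteq> i \<and> A $ i $ j > 0}"

text \<open>Note the transposition: information flows from \<open>i\<close> to \<open>j\<close> along an edge of weight \<open>A $ j $ i\<close>.\<close>

definition edges :: "real^'n^'n \<Rightarrow> ('n \<times> 'n) set" where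
  "edges A = {(i, j). A $ j $ i > 0}"

definition leaders :: "real^'n^'n \<Rightarrow> 'n set" where
  "leaders A = {i. \<forall>j. j \<noteq> i \<longrightarrow> (i, j) \<in> (edges A)\<^sup>*}"

definition followers :: "real^'n^'n \<Rightarrow> 'n set" where
  "followers A = - leaders A"

text \<open>
  The local communication topology among the agents in \<open>S\<close> has edge set \<open>Restr (edges A) S\<close> and
  weights inherited from \<open>A\<close>. Connectedness is only meaningful for an undirected topology.
\<close>

definition local_undirected :: "real^'n^'n \<Rightarrow> 'n set \<Rightarrow> bool" where
  "local_undirected A S \<longleftrightarrow> (\<forall>i\<in>S. \<forall>j\<in>S. A $ i $ j = A $ j $ i)"

definition local_connected :: "real^'n^'n \<Rightarrow> 'n set \<Rightarrow> bool" where
  "local_connected A S \<longleftrightarrow>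
     (\<forall>i\<in>S. \<forall>j\<in>S. i \<noteq> j \<longrightarrow> (i, j) \<in> (Restr (edges A) S)\<^sup>*)"

definition protocol :: "real^'n^'n \<Rightarrow> ('n \<Rightarrow> 'n \<Rightarrow> real) \<Rightarrow> real^'n \<Rightarrow> real^'n" where
  "protocol A \<alpha> y = (\<chi> i. \<Sum>j\<in>neighbors A i. A $ i $ j * sig (y $ j - y $ i) (\<alpha> i j))"

text \<open>
  A trajectory is a total function, of which only the values on \<open>{0..}\<close> matter; the derivative
  at \<open>0\<close> is the right-hand one.
\<close>

definition is_solution ::
  "real^'n^'n \<Rightarrow> ('n \<Rightarrow> 'n \<Rightarrow> real) \<Rightarrow> (real \<Rightarrow> real^'n) \<Rightarrow> bool" where
  "is_solution A \<alpha> x \<longleftrightarrow>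
     (\<forall>t\<ge>0. (x has_vector_derivative protocol A \<alpha> (x t)) (at t within {0..}))"

definition final_common_state :: "(real \<Rightarrow> real^'n) \<Rightarrow> real \<Rightarrow> bool" where
  "final_common_state x \<kappa> \<longleftrightarrow> (\<exists>T\<ge>0. \<forall>t\<ge>T. \<forall>j. x t $ j = \<kappa>)"

definition solves_finite_time_consensus ::
  "real^'n^'n \<Rightarrow> ('n \<Rightarrow> 'n \<Rightarrow> real) \<Rightarrow> bool" where
  "solves_finite_time_consensus A \<alpha> \<longleftrightarrow>
     (\<forall>x\<^sub>0 x. is_solution A \<alpha> x \<and> x 0 = x\<^sub>0 \<longrightarrow>
        (\<forall>j k. ((\<lambda>t. \<bar>x t $ j - x t $ k\<bar>) \<longlongrightarrow> 0) at_top) \<and>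
        (\<exists>\<kappa>. final_common_state x \<kappa>))"

end

theory Submission
  imports Defs
begin

text \<open>
  The leader \<open>l\<close> listens to nobody: an agent that influences a root of a spanning tree is itself a
  root. So its state is a constant \<open>\<kappa>\<close>, and it remains to see that
  \<open>W = \<Sum>\<^sub>i (x\<^sub>i - \<kappa>)\<^sup>2\<close> vanishes in finite time. This follows from a differential
  inequality \<open>W' \<le> - c W\<^sup>q\<close> with \<open>q < 1\<close>, under which \<open>W powr (1 - q)\<close> decreases at least linearly
  as long as it is positive (\<open>sublinear_decay_extinction\<close>).

  The inequality has two ingredients. Between two followers the forces are equal and opposite,
  while the leader only pulls towards \<open>\<kappa>\<close>; symmetrising the double sum for \<open>W'\<close> yields
  \<open>W' \<le> - \<Sum>\<^sub>i \<Sum>\<^sub>j a\<^sub>i\<^sub>j \<bar>x\<^sub>j - x\<^sub>i\<bar> powr (1 + \<alpha>\<^sub>i\<^sub>j)\<close>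
  (\<open>leader_distance_dissipation\<close>). Conversely the leader reaches every agent along edges, so by
  the triangle inequality some edge carries a disagreement of the order of \<open>sqrt W\<close>
  (\<open>edge_with_comparable_disagreement\<close>). As \<open>W\<close> is nonincreasing, the different exponents on the
  edges can be replaced by the largest of them at the cost of a constant depending on \<open>W 0\<close>. With
  \<open>p < 2\<close> an upper bound for \<open>1 + \<alpha>\<^sub>i\<^sub>j\<close>, the dissipation is then at least
  \<open>c W powr (p / 2)\<close>.
\<close>

section \<open>Extinction in finite time\<close>

text \<open>
  The derivative of a power is unavailable where \<open>W = 0\<close>; but by monotonicity
  \<open>W T > 0\<close> forces \<open>W > 0\<close> on all of \<open>{0..T}\<close>.
\<close>

lemma sublinear_decay_extinction:
  fixes W W' :: "real \<Rightarrow> real"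
  assumes deriv: "\<And>t. t \<ge> 0 \<Longrightarrow> (W has_real_derivative W' t) (at t within {0..})"
    and nonneg: "\<And>t. t \<ge> 0 \<Longrightarrow> W t \<ge> 0"
    and decay: "\<And>t. t \<ge> 0 \<Longrightarrow> W' t \<le> - c * W t powr q"
    and "c > 0" "q < 1"
    and late: "T \<ge> W 0 powr (1 - q) / (c * (1 - q))"
  shows "W T = 0"
proof (rule ccontr)
  assume "W T \<noteq> 0"
  have k: "c * (1 - q) > 0"
    using assms by simp
  have "0 \<le> W 0 powr (1 - q) / (c * (1 - q))"
    using k by (intro divide_nonneg_pos) auto
  then have T: "T \<ge> 0"
    using late by linarith
  have interior: "(W has_real_derivative W' t) (at t)" if "t > 0" for t
    using deriv[of t] that at_within_interior[of t "{0..}"] by simp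
  have cont: "continuous_on {0..T} W"
    using DERIV_continuous_on[of "{0..}" W W'] deriv continuous_on_subset by fastforce
  have W'_nonpos: "W' t \<le> 0" if "t \<ge> 0" for t
  proof -
    have "W' t \<le> - (c * W t powr q)"
      using decay[OF that] by simp
    also have "\<dots> \<le> 0"
      using \<open>c > 0\<close> by simp
    finally show ?thesis .
  qed
  have "W T \<le> W t" if t: "t \<in> {0..T}" for t
  proof (rule DERIV_nonpos_imp_decreasing_open[where f = W])
    show "\<exists>d. (W has_real_derivative d) (at s) \<and> d \<le> 0" if "t < s" "s < T" for s
      using interior[of s] W'_nonpos[of s] that t by auto
  qed (use t continuous_on_subset[OF cont] in auto)
  then have pos: "W t > 0" if "t \<in> {0..T}" for t
    using that nonneg[OF T] \<open>W T \<noteq> 0\<close> by (metis less_eq_real_def order_less_le_trans)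
  define g where "g t = W t powr (1 - q) + c * (1 - q) * t" for t
  have "g T \<le> g 0"
  proof (rule DERIV_nonpos_imp_decreasing_open[OF T])
    show "continuous_on {0..T} g"
      unfolding g_def using pos by (intro continuous_intros cont) force+
    fix t assume t: "0 < t" "t < T"
    have W: "W t > 0" using pos t by auto
    have "(g has_real_derivative (1 - q) * W t powr (- q) * W' t + c * (1 - q)) (at t)"
      unfolding g_def using interior[OF t(1)] W
      by (auto intro!: derivative_eq_intros)
    moreover have "W t powr (- q) * W' t \<le> - c"
    proof -
      have "W t powr (- q) * W' t \<le> W t powr (- q) * (- c * W t powr q)"
        using decay[of t] t by (intro mult_left_mono) auto
      also have "\<dots> = - c"
        using W by (simp add: powr_minus)
      finally show ?thesis .
    qed
    then have "(1 - q) * (W t powr (- q) * W' t) \<le> (1 - q) * (- c)"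
      using \<open>q < 1\<close> by (intro mult_left_mono) auto
    then have "(1 - q) * W t powr (- q) * W' t + c * (1 - q) \<le> 0"
      by (simp add: algebra_simps)
    ultimately show "\<exists>d. (g has_real_derivative d) (at t) \<and> d \<le> 0"
      by blast
  qed
  moreover have "W T powr (1 - q) > 0"
    using \<open>W T \<noteq> 0\<close> by simp
  moreover have "W 0 powr (1 - q) \<le> c * (1 - q) * T"
    using late k by (simp add: pos_divide_le_eq mult.commute)
  ultimately show False
    by (simp add: g_def)
qed

section \<open>The protocol as a sum of pairwise forces\<close>

lemma sig_minus: "sig (- r) \<alpha> = - sig r \<alpha>"
  by (simp add: sig_def sgn_minus)

lemma mult_sig: "r * sig r \<alpha> = \<bar>r\<bar> powr (1 + \<alpha>)"
  by (cases r "0 :: real" rule: linorder_cases) (auto simp: sig_def powr_add)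

lemma protocol_eq_sum_UNIV:
  fixes A :: "real^'n^'n"
  assumes "\<And>i j. A $ i $ j \<ge> 0" and "\<And>i. A $ i $ i = 0"
  shows "protocol A \<alpha> z $ i = (\<Sum>j\<in>UNIV. A $ i $ j * sig (z $ j - z $ i) (\<alpha> i j))"
  unfolding protocol_def
proof (simp, rule sum.mono_neutral_left)
  show "\<forall>j\<in>UNIV - neighbors A i. A $ i $ j * sig (z $ j - z $ i) (\<alpha> i j) = 0"
    using assms by (auto simp: neighbors_def less_le)
qed auto

lemma unique_leader_hears_nobody:
  fixes A :: "real^'n^'n"
  assumes "\<And>i j. A $ i $ j \<ge> 0" and "\<And>i. A $ i $ i = 0" and "leaders A = {l}"
  shows "A $ l $ j = 0"
proof (rule ccontr)
  assume *: "A $ l $ j \<noteq> 0"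
  with assms have "(j, l) \<in> edges A" "j \<noteq> l"
    by (auto simp: edges_def less_le)
  moreover have "(l, k) \<in> (edges A)\<^sup>*" for k
    using assms(3) by (cases "k = l") (auto simp: leaders_def)
  ultimately have "j \<in> leaders A"
    by (auto simp: leaders_def intro: converse_rtrancl_into_rtrancl)
  with assms(3) \<open>j \<noteq> l\<close> show False
    by simp
qed

text \<open>Adding a double sum to its transpose leaves only the symmetric part of the summand.\<close>

lemma sum_nonpos_of_symmetrised_nonpos:
  fixes g :: "'a::finite \<Rightarrow> 'a \<Rightarrow> real"
  assumes "\<And>i j. g i j + g j i \<le> 0"
  shows "(\<Sum>i\<in>UNIV. \<Sum>j\<in>UNIV. g i j) \<le> 0"
proof -
  have "2 * (\<Sum>i\<in>UNIV. \<Sum>j\<in>UNIV. g i j) = (\<Sum>i\<in>UNIV. \<Sum>j\<in>UNIV. g i j + g j i)"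
    using sum.swap[of g UNIV UNIV] by (simp add: sum.distrib)
  also have "\<dots> \<le> 0"
    by (intro sum_nonpos assms)
  finally show ?thesis by simp
qed

text \<open>
  With \<open>y\<^sub>i = z\<^sub>i - z\<^sub>l\<close> and \<open>f\<^sub>i\<^sub>j\<close> the force of \<open>j\<close> on \<open>i\<close>, the claim is
  \<open>\<Sum>\<^sub>i\<^sub>j (y\<^sub>i + y\<^sub>j) f\<^sub>i\<^sub>j \<le> 0\<close>. A pair of followers contributes nothing since
  \<open>f\<^sub>i\<^sub>j = - f\<^sub>j\<^sub>i\<close>, and a pair \<open>i, l\<close> contributes \<open>y\<^sub>i f\<^sub>i\<^sub>l \<le> 0\<close> since
  \<open>y\<^sub>l = 0\<close> and \<open>f\<^sub>l\<^sub>i = 0\<close>.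
\<close>

lemma leader_distance_dissipation:
  fixes A :: "real^'n^'n"
  assumes nonneg: "\<And>i j. A $ i $ j \<ge> 0" and diag: "\<And>i. A $ i $ i = 0"
    and leader: "leaders A = {l}"
    and undirected: "local_undirected A (followers A)"
    and sym: "\<And>i j. j \<in> neighbors A i \<Longrightarrow> i \<in> neighbors A j \<Longrightarrow> \<alpha> i j = \<alpha> j i"
  shows "(\<Sum>i\<in>UNIV. 2 * (z $ i - z $ l) * protocol A \<alpha> z $ i)
    \<le> - (\<Sum>i\<in>UNIV. \<Sum>j\<in>UNIV. A $ i $ j * \<bar>z $ j - z $ i\<bar> powr (1 + \<alpha> i j))"
proof -
  define y where "y i = z $ i - z $ l" for i
  define f where "f i j = A $ i $ j * sig (z $ j - z $ i) (\<alpha> i j)" for i j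
  have fl: "f l j = 0" for j
    using unique_leader_hears_nobody[OF nonneg diag leader] by (simp add: f_def)
  have work: "(y j - y i) * f i j = A $ i $ j * \<bar>z $ j - z $ i\<bar> powr (1 + \<alpha> i j)" for i j
    by (simp add: y_def f_def mult.left_commute mult_sig)
  have pull: "y i * f i l \<le> 0" for i
  proof -
    have "0 \<le> (y l - y i) * f i l"
      unfolding work using nonneg by simp
    then show ?thesis
      by (simp add: y_def algebra_simps)
  qed
  have antisym: "f j i = - f i j" if "i \<noteq> l" "j \<noteq> l" for i j
  proof (cases "A $ i $ j = 0")
    case True
    then have "A $ j $ i = 0"
      using undirected that leader by (simp add: local_undirected_def followers_def)
    with True show ?thesis by (simp add: f_def)
  next
    case False
    have A: "A $ j $ i = A $ i $ j"
      using undirected that leader by (simp add: local_undirected_def followers_def)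
    have "\<alpha> i j = \<alpha> j i"
      using False A nonneg[of i j] diag by (intro sym) (auto simp: neighbors_def)
    with A show ?thesis
      using sig_minus[of "z $ j - z $ i" "\<alpha> i j"] by (simp add: f_def)
  qed
  have pair: "(y i + y j) * f i j + (y j + y i) * f j i \<le> 0" for i j
  proof (cases "i = l \<or> j = l")
    case True
    then show ?thesis
      using pull[of i] pull[of j] by (auto simp: fl y_def)
  next
    case False
    then show ?thesis
      using antisym[of i j] by (simp add: algebra_simps)
  qed
  have "(\<Sum>i\<in>UNIV. 2 * (z $ i - z $ l) * protocol A \<alpha> z $ i)
      + (\<Sum>i\<in>UNIV. \<Sum>j\<in>UNIV. (y j - y i) * f i j)
      = (\<Sum>i\<in>UNIV. \<Sum>j\<in>UNIV. 2 * y i * f i j + (y j - y i) * f i j)"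
    by (simp add: protocol_eq_sum_UNIV[OF nonneg diag] sum.distrib sum_distrib_left y_def f_def)
  also have "\<dots> = (\<Sum>i\<in>UNIV. \<Sum>j\<in>UNIV. (y i + y j) * f i j)"
    by (intro sum.cong refl) (simp add: algebra_simps)
  also have "\<dots> \<le> 0"
    using pair by (rule sum_nonpos_of_symmetrised_nonpos)
  finally show ?thesis
    by (simp add: work)
qed

section \<open>Coercivity of the dissipation\<close>

lemma reachable_disagreement_bound:
  assumes "(l, i) \<in> E\<^sup>*"
  shows "\<exists>K\<ge>0. \<forall>(z::'a \<Rightarrow> real) \<delta>.
    (\<forall>(j, k)\<in>E. \<bar>z j - z k\<bar> \<le> \<delta>) \<longrightarrow> \<bar>z i - z l\<bar> \<le> K * \<delta>"
  using assms
proof (induction rule: rtrancl_induct)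
  case base
  show ?case by (intro exI[of _ 0]) auto
next
  case (step i k)
  from step.IH obtain K where "K \<ge> 0" and K: "\<And>(z::'a \<Rightarrow> real) \<delta>.
      \<forall>(j, k)\<in>E. \<bar>z j - z k\<bar> \<le> \<delta> \<Longrightarrow> \<bar>z i - z l\<bar> \<le> K * \<delta>"
    by blast
  have "\<bar>z k - z l\<bar> \<le> (K + 1) * \<delta>" if "\<forall>(j, k)\<in>E. \<bar>z j - z k\<bar> \<le> \<delta>" for z \<delta>
  proof -
    have "\<bar>z i - z k\<bar> \<le> \<delta>"
      using that step.hyps by blast
    with K[OF that] show ?thesis
      by (simp add: algebra_simps)
  qed
  with \<open>K \<ge> 0\<close> show ?case
    by (intro exI[of _ "K + 1"]) auto
qed

text \<open>
  The edge with the largest disagreement does it: the distance of each agent from \<open>l\<close> is at most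
  that disagreement times the length of a path from \<open>l\<close>. The bound \<open>C \<ge> 1\<close> makes \<open>C\<close> a
  harmless divisor later.
\<close>

lemma edge_with_comparable_disagreement:
  fixes E :: "('n::finite \<times> 'n) set"
  assumes reach: "\<And>i. (l, i) \<in> E\<^sup>*" and "E \<noteq> {}"
  obtains C where "C \<ge> 1"
    and "\<And>z :: 'n \<Rightarrow> real. \<exists>(j, i)\<in>E. sqrt (\<Sum>k\<in>UNIV. (z k - z l)\<^sup>2) \<le> C * \<bar>z j - z i\<bar>"
proof -
  have "\<forall>i. \<exists>K\<ge>0. \<forall>(z::'n \<Rightarrow> real) \<delta>.
      (\<forall>(j, k)\<in>E. \<bar>z j - z k\<bar> \<le> \<delta>) \<longrightarrow> \<bar>z i - z l\<bar> \<le> K * \<delta>"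
    using reachable_disagreement_bound[OF reach] by blast
  then obtain K where K0: "\<And>i. K i \<ge> 0" and K: "\<And>i (z::'n \<Rightarrow> real) \<delta>.
      \<forall>(j, k)\<in>E. \<bar>z j - z k\<bar> \<le> \<delta> \<Longrightarrow> \<bar>z i - z l\<bar> \<le> K i * \<delta>"
    by metis
  define C where "C = 1 + (\<Sum>i\<in>UNIV. K i)"
  have "C \<ge> 1"
    unfolding C_def using K0 by (simp add: sum_nonneg)
  moreover have "\<exists>(j, i)\<in>E. sqrt (\<Sum>k\<in>UNIV. (z k - z l)\<^sup>2) \<le> C * \<bar>z j - z i\<bar>" for z :: "'n \<Rightarrow> real"
  proof -
    define D where "D = (\<lambda>(j, i). \<bar>z j - z i\<bar>) ` E"
    have D: "finite D" "D \<noteq> {}"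
      using \<open>E \<noteq> {}\<close> by (auto simp: D_def)
    from Max_in[OF D] obtain j i where ji: "(j, i) \<in> E" "Max D = \<bar>z j - z i\<bar>"
      by (auto simp: D_def)
    have dev: "\<bar>z k - z l\<bar> \<le> K k * Max D" for k
    proof (rule K, clarify)
      fix a b assume "(a, b) \<in> E"
      then show "\<bar>z a - z b\<bar> \<le> Max D"
        using D(1) by (intro Max_ge) (auto simp: D_def)
    qed
    have "sqrt (\<Sum>k\<in>UNIV. (z k - z l)\<^sup>2) \<le> (\<Sum>k\<in>UNIV. \<bar>z k - z l\<bar>)"
      using L2_set_le_sum_abs[of "\<lambda>k. z k - z l" UNIV] by (simp add: L2_set_def)
    also have "\<dots> \<le> (\<Sum>k\<in>UNIV. K k) * Max D"
      unfolding sum_distrib_right by (intro sum_mono dev)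
    also have "\<dots> \<le> C * \<bar>z j - z i\<bar>"
      unfolding ji(2) C_def by (intro mult_right_mono) auto
    finally show ?thesis
      using ji(1) by blast
  qed
  ultimately show thesis
    by (rule that)
qed

text \<open>
  Different edges scale with different powers of \<open>W\<close>, so a common power \<open>p / 2\<close> is possible only
  on a sublevel set of \<open>W\<close>, and the constant depends on it.
\<close>

lemma dissipation_coercive:
  fixes A :: "real^'n^'n"
  assumes nonneg: "\<And>i j. A $ i $ j \<ge> 0"
    and reach: "\<And>i. (l, i) \<in> (edges A)\<^sup>*" and nonempty: "edges A \<noteq> {}"
    and exponent: "\<And>i j. A $ i $ j > 0 \<Longrightarrow> 0 < \<alpha> i j \<and> 1 + \<alpha> i j \<le> p"
  obtains c where "c > 0"
    and "\<And>z :: real^'n. (\<Sum>k\<in>UNIV. (z $ k - z $ l)\<^sup>2) \<le> R \<Longrightarrow>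
      c * (\<Sum>k\<in>UNIV. (z $ k - z $ l)\<^sup>2) powr (p / 2)
        \<le> (\<Sum>i\<in>UNIV. \<Sum>j\<in>UNIV. A $ i $ j * \<bar>z $ j - z $ i\<bar> powr (1 + \<alpha> i j))"
proof -
  obtain C where "C \<ge> 1" and C: "\<And>z :: 'n \<Rightarrow> real.
      \<exists>(j, i)\<in>edges A. sqrt (\<Sum>k\<in>UNIV. (z k - z l)\<^sup>2) \<le> C * \<bar>z j - z i\<bar>"
    using edge_with_comparable_disagreement[OF reach nonempty] by blast
  define a where "a = Min ((\<lambda>(j, i). A $ i $ j) ` edges A)"
  have "a > 0"
    unfolding a_def using nonempty by (subst Min_gr_iff) (auto simp: edges_def)
  have a_le: "a \<le> A $ i $ j" if "(j, i) \<in> edges A" for i j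
    unfolding a_def using that by (intro Min_le) (auto intro: rev_image_eqI)
  define S where "S = max 1 (sqrt R)"
  have "S \<ge> 1" by (simp add: S_def)
  have CS: "C * S > 0" "S \<le> C * S"
    using \<open>C \<ge> 1\<close> \<open>S \<ge> 1\<close> mult_right_mono[of 1 C S] by auto
  define c where "c = a / (C * S) powr p"
  have "c > 0"
    unfolding c_def using \<open>a > 0\<close> CS(1) by (intro divide_pos_pos) auto
  moreover have "c * (\<Sum>k\<in>UNIV. (z $ k - z $ l)\<^sup>2) powr (p / 2)
        \<le> (\<Sum>i\<in>UNIV. \<Sum>j\<in>UNIV. A $ i $ j * \<bar>z $ j - z $ i\<bar> powr (1 + \<alpha> i j))"
    if R: "(\<Sum>k\<in>UNIV. (z $ k - z $ l)\<^sup>2) \<le> R" for z :: "real^'n"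
  proof -
    define W where "W = (\<Sum>k\<in>UNIV. (z $ k - z $ l)\<^sup>2)"
    have "W \<ge> 0" by (simp add: W_def sum_nonneg)
    obtain i j where ji: "(j, i) \<in> edges A" and d: "sqrt W \<le> C * \<bar>z $ j - z $ i\<bar>"
      using C[of "($) z"] unfolding W_def by blast
    \<comment> \<open>Rescaled so that \<open>u \<le> 1\<close>: on \<open>{0..1}\<close> a larger exponent gives a smaller power.\<close>
    define u where "u = sqrt W / (C * S)"
    have "sqrt W \<le> S"
      using R by (simp add: W_def S_def le_max_iff_disj)
    then have u: "0 \<le> u" "u \<le> 1"
      using CS \<open>W \<ge> 0\<close> by (auto simp: u_def)
    have "C * \<bar>z $ j - z $ i\<bar> * 1 \<le> C * \<bar>z $ j - z $ i\<bar> * S"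
      using \<open>C \<ge> 1\<close> \<open>S \<ge> 1\<close> by (intro mult_left_mono) auto
    with d have "sqrt W \<le> C * \<bar>z $ j - z $ i\<bar> * S"
      by simp
    then have u_le: "u \<le> \<bar>z $ j - z $ i\<bar>"
      using CS by (simp add: u_def pos_divide_le_eq mult_ac)
    have e: "0 < \<alpha> i j" "1 + \<alpha> i j \<le> p"
      using exponent[of i j] ji by (auto simp: edges_def)
    have "c * W powr (p / 2) = a * u powr p"
      using \<open>W \<ge> 0\<close> CS
      by (simp add: c_def u_def powr_divide powr_half_sqrt[symmetric] powr_powr)
    also have "\<dots> \<le> a * u powr (1 + \<alpha> i j)"
      using \<open>a > 0\<close> u e by (intro mult_left_mono powr_mono') auto
    also have "\<dots> \<le> A $ i $ j * \<bar>z $ j - z $ i\<bar> powr (1 + \<alpha> i j)"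
      using a_le[OF ji] u_le u e nonneg by (intro mult_mono powr_mono2) auto
    also have "\<dots> \<le> (\<Sum>j\<in>UNIV. A $ i $ j * \<bar>z $ j - z $ i\<bar> powr (1 + \<alpha> i j))"
      by (rule member_le_sum) (auto simp: nonneg)
    also have "\<dots> \<le> (\<Sum>i\<in>UNIV. \<Sum>j\<in>UNIV. A $ i $ j * \<bar>z $ j - z $ i\<bar> powr (1 + \<alpha> i j))"
      by (rule member_le_sum[where f = "\<lambda>i. \<Sum>j\<in>UNIV. A $ i $ j * \<bar>z $ j - z $ i\<bar> powr (1 + \<alpha> i j)"])
        (auto simp: nonneg intro!: sum_nonneg)
    finally show ?thesis
      by (simp add: W_def)
  qed
  ultimately show thesis
    by (rule that)
qed

section \<open>Solutions\<close>

lemma solution_component_deriv: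
  assumes "is_solution A \<alpha> x" and "t \<ge> 0"
  shows "((\<lambda>s. x s $ i) has_real_derivative protocol A \<alpha> (x t) $ i) (at t within {0..})"
  unfolding has_real_derivative_iff_has_vector_derivative
  using assms by (intro bounded_linear.has_vector_derivative[OF bounded_linear_vec_nth])
    (simp add: is_solution_def)

lemma leader_state_constant:
  fixes A :: "real^'n^'n"
  assumes "\<And>i j. A $ i $ j \<ge> 0" and "\<And>i. A $ i $ i = 0" and "leaders A = {l}"
    and sol: "is_solution A \<alpha> x" and "t \<ge> 0"
  shows "x t $ l = x 0 $ l"
proof -
  have "protocol A \<alpha> z $ l = 0" for z
    unfolding protocol_eq_sum_UNIV[OF assms(1,2)]
    using unique_leader_hears_nobody[OF assms(1-3)] by simp
  then have "((\<lambda>s. x s $ l) has_real_derivative 0) (at s within {0..})" if "s \<in> {0..}" for s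
    using solution_component_deriv[OF sol, of s l] that by simp
  then show ?thesis
    using has_field_derivative_zero_constant[of "{0..}" "\<lambda>s. x s $ l"] \<open>t \<ge> 0\<close> by fastforce
qed

lemma finite_time_tracking_of_leader:
  fixes A :: "real^'n^'n"
  assumes card: "CARD('n) \<ge> 2"
    and nonneg: "\<And>i j. A $ i $ j \<ge> 0" and diag: "\<And>i. A $ i $ i = 0"
    and range: "\<And>i j. j \<in> neighbors A i \<Longrightarrow> 0 < \<alpha> i j \<and> \<alpha> i j < 1"
    and leader: "leaders A = {l}"
    and undirected: "local_undirected A (followers A)"
    and sym: "\<And>i j. j \<in> neighbors A i \<Longrightarrow> i \<in> neighbors A j \<Longrightarrow> \<alpha> i j = \<alpha> j i"
    and sol: "is_solution A \<alpha> x"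
  shows "final_common_state x (x 0 $ l)"
proof -
  define Q where
    "Q z = (\<Sum>i\<in>UNIV. \<Sum>j\<in>UNIV. A $ i $ j * \<bar>z $ j - z $ i\<bar> powr (1 + \<alpha> i j))" for z :: "real^'n"
  define W where "W t = (\<Sum>k\<in>UNIV. (x t $ k - x 0 $ l)\<^sup>2)" for t
  define W' where "W' t = (\<Sum>i\<in>UNIV. 2 * (x t $ i - x t $ l) * protocol A \<alpha> (x t) $ i)" for t
  have xl: "x t $ l = x 0 $ l" if "t \<ge> 0" for t
    using leader_state_constant[OF nonneg diag leader sol that] .
  have W_nonneg: "W t \<ge> 0" for t
    by (simp add: W_def sum_nonneg)
  have W_deriv: "(W has_real_derivative W' t) (at t within {0..})" if "t \<ge> 0" for t
    unfolding W_def W'_def xl[OF that]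
    by (auto intro!: derivative_eq_intros solution_component_deriv[OF sol that] sum.cong)
  have W'_le: "W' t \<le> - Q (x t)" for t
    unfolding W'_def Q_def
    by (rule leader_distance_dissipation[OF nonneg diag leader undirected sym])
  have "Q z \<ge> 0" for z
    unfolding Q_def using nonneg by (intro sum_nonneg) auto
  then have W'_nonpos: "W' t \<le> 0" for t
    using W'_le[of t] by (meson neg_le_0_iff_le order_trans)
  have W_le: "W t \<le> W 0" if "t \<ge> 0" for t
  proof (rule DERIV_nonpos_imp_decreasing_open[OF that])
    show "continuous_on {0..t} W"
      using DERIV_continuous_on[of "{0..}" W W'] W_deriv continuous_on_subset by fastforce
    show "\<exists>d. (W has_real_derivative d) (at s) \<and> d \<le> 0" if "0 < s" "s < t" for s
      using W_deriv[of s] W'_nonpos[of s] at_within_interior[of s "{0..}"] that by auto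
  qed
  have reach: "(l, i) \<in> (edges A)\<^sup>*" for i
    using leader by (cases "i = l") (auto simp: leaders_def)
  have nonempty: "edges A \<noteq> {}"
  proof
    assume "edges A = {}"
    then have "i = l" for i
      using reach[of i] by simp
    then have "UNIV = {l}"
      by auto
    then have "CARD('n) = 1"
      by (metis card_1_singleton_iff One_nat_def)
    with card show False by simp
  qed
  have edge_exponent: "0 < \<alpha> i j \<and> \<alpha> i j < 1" if "A $ i $ j > 0" for i j
  proof -
    have "j \<noteq> i" using that diag[of i] by auto
    with that show ?thesis
      by (intro range) (simp add: neighbors_def)
  qed
  define p where "p = 1 + Max ((\<lambda>(j, i). \<alpha> i j) ` edges A)"
  have "p < 2"
    using nonempty edge_exponent by (auto simp: p_def edges_def)
  have p: "0 < \<alpha> i j \<and> 1 + \<alpha> i j \<le> p" if "A $ i $ j > 0" for i j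
    using edge_exponent[OF that] that
    by (auto simp: p_def edges_def intro!: Max_ge intro: rev_image_eqI[of "(j, i)"])
  obtain c where "c > 0" and c: "\<And>z :: real^'n. (\<Sum>k\<in>UNIV. (z $ k - z $ l)\<^sup>2) \<le> W 0 \<Longrightarrow>
      c * (\<Sum>k\<in>UNIV. (z $ k - z $ l)\<^sup>2) powr (p / 2) \<le> Q z"
    unfolding Q_def using dissipation_coercive[of A l \<alpha> p, OF nonneg reach nonempty p] by blast
  have decay: "W' t \<le> - c * W t powr (p / 2)" if "t \<ge> 0" for t
    using W'_le[of t] c[of "x t"] W_le[OF that] by (simp add: W_def xl[OF that])
  define T where "T = W 0 powr (1 - p / 2) / (c * (1 - p / 2))"
  have "x t $ j = x 0 $ l" if "t \<ge> T" for t j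
  proof -
    have "W t = 0"
      using sublinear_decay_extinction[OF W_deriv W_nonneg decay \<open>c > 0\<close>] \<open>p < 2\<close> that
      by (simp add: T_def)
    then show ?thesis
      by (simp add: W_def sum_nonneg_eq_0_iff)
  qed
  moreover have "T \<ge> 0"
    unfolding T_def using \<open>c > 0\<close> \<open>p < 2\<close> by (intro divide_nonneg_pos) auto
  ultimately show ?thesis
    unfolding final_common_state_def by blast
qed

theorem theorem3:
  fixes A :: "real^'n^'n" and \<alpha> :: "'n \<Rightarrow> 'n \<Rightarrow> real" and l :: 'n
  assumes "CARD('n) \<ge> 2"
    and "\<And>i j. A $ i $ j \<ge> 0"
    and "\<And>i. A $ i $ i = 0"
    and "\<And>i j. j \<in> neighbors A i \<Longrightarrow> 0 < \<alpha> i j \<and> \<alpha> i j < 1"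
    and "leaders A = {l}"
    and "local_undirected A (followers A)"
    and "local_connected A (followers A)"
    and "\<And>i j. j \<in> neighbors A i \<Longrightarrow> i \<in> neighbors A j \<Longrightarrow> \<alpha> i j = \<alpha> j i"
  shows "solves_finite_time_consensus A \<alpha> \<and>
    (\<forall>x \<kappa>. is_solution A \<alpha> x \<longrightarrow> final_common_state x \<kappa> \<longrightarrow> (\<forall>t\<ge>0. x t $ l = \<kappa>))"
proof (intro conjI allI impI)
  have "((\<lambda>t. \<bar>x t $ j - x t $ k\<bar>) \<longlongrightarrow> 0) at_top \<and> final_common_state x (x 0 $ l)"
    if "is_solution A \<alpha> x" for x j k
  proof
    show "final_common_state x (x 0 $ l)"
      using finite_time_tracking_of_leader[OF assms(1-6,8) that] .
    then obtain T where "\<And>t j. t \<ge> T \<Longrightarrow> x t $ j = x 0 $ l"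
      unfolding final_common_state_def by blast
    then have "eventually (\<lambda>t. \<bar>x t $ j - x t $ k\<bar> = 0) at_top"
      unfolding eventually_at_top_linorder by (intro exI[of _ T]) simp
    then show "((\<lambda>t. \<bar>x t $ j - x t $ k\<bar>) \<longlongrightarrow> 0) at_top"
      by (rule tendsto_eventually)
  qed
  then show "solves_finite_time_consensus A \<alpha>"
    unfolding solves_finite_time_consensus_def by blast
next
  fix x \<kappa> and t :: real
  assume sol: "is_solution A \<alpha> x" and final: "final_common_state x \<kappa>" and "t \<ge> 0"
  from final obtain T where "T \<ge> 0" "x T $ l = \<kappa>"
    unfolding final_common_state_def by blast
  with \<open>t \<ge> 0\<close> show "x t $ l = \<kappa>"
    using leader_state_constant[OF assms(2,3,5) sol] by metis
qed

end
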